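(* Let $m\in\mathbb{N}$ and $T\subseteq H_m$. Then $T$ is thick if and only if $\tilde{T}:=\{\alpha\in S(G): T\in\alpha(m)\}$ contains a minimal right ideal of $S(G)$.
   Context: Let $L$ be a relational language and $\mathbf{K}$ a Fraïssé structure, i.e. a countably infinite $L$-structure that is ultrahomogeneous (every isomorphism between finite substructures of $\mathbf{K}$ extends to an automorphism of $\mathbf{K}$). Let $G=\mathrm{Aut}(\mathbf{K})$. Fix an exhaustion $\mathbf{K}=\bigcup_n\mathbf{A}_n$ by finite substructures with $\mathbf{A}_m\subseteq\mathbf{A}_n$ for $m\le n$. $\mathrm{Emb}(\mathbf{A},\mathbf{B})$ is the set of embeddings of $\mathbf{A}$ into $\mathbf{B}$, and $H_n=\mathrm{Emb}(\mathbf{A}_n,\mathbf{K})$. $G$ acts on the right on $2^{H_m}$ (product topology) by $(\chi_A\cdot g)(f)=\chi_A(g\circ f)$ for $A\subseteq H_m$, $g\in G$, $f\in H_m$. A set $T\subseteq H_m$ is thick if $\chi_{H_m}\in\overline{\chi_T\cdot G}$. $\beta H_n$ is the compact space of ultrafilters on the discrete set $H_n$. For $m\le n$, the restriction map $H_n\to H_m$, $x\mapsto x|_{\mathbf{A}_m}$, extends to a continuous map $\tilde{\imath}^n_m:\beta H_n\to\beta H_m$. $S(G)=\varprojlim\beta H_n$ is the inverse limit along the maps $\tilde{\imath}^n_m$; for $\alpha\in S(G)$, $\alpha(m)\in\beta H_m$ is its $m$-th coordinate. For $\alpha\in S(G)$ and $f\in H_m$, let $\alpha\cdot f\in\beta H_m$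 be given by: $S\in\alpha\cdot f$ iff $\{x\in H_n: x\circ f\in S\}\in\alpha(n)$, where $n\ge m$ is large enough that $\mathrm{ran}(f)\subseteq\mathbf{A}_n$ (independent of such $n$). $S(G)$ is a compact left-topological semigroup with multiplication: for $S\subseteq H_m$, $S\in(\alpha\gamma)(m)$ iff $\{f\in H_m: S\in\alpha\cdot f\}\in\gamma(m)$. A right ideal is a nonempty $R\subseteq S(G)$ with $R\,S(G)\subseteq R$; a minimal right ideal is one containing no properly smaller right ideal. *)

theory Defs
  imports "HOL-Analysis.Analysis"
begin

section \<open>Relational structures and embeddings\<close>

record 'r rel_language =
  symbols :: "'r set"
  arity :: "'r \<Rightarrow> nat"

record ('a, 'r) rel_structure =
  universe :: "'a set"
  interp :: "'r \<Rightarrow> 'a list set"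

definition tuples :: "'r rel_language \<Rightarrow> 'r \<Rightarrow> 'a set \<Rightarrow> 'a list set" where
  "tuples L R X = {xs. length xs = arity L R \<and> set xs \<subseteq> X}"

definition is_structure :: "'r rel_language \<Rightarrow> ('a, 'r) rel_structure \<Rightarrow> bool" where
  "is_structure L M \<longleftrightarrow> (\<forall>R\<in>symbols L. interp M R \<subseteq> tuples L R (universe M))"

definition substructure ::
  "'r rel_language \<Rightarrow> ('a, 'r) rel_structure \<Rightarrow> ('a, 'r) rel_structure \<Rightarrow> bool" where
  "substructure L N M \<longleftrightarrow> universe N \<subseteq> universe M \<and>
     (\<forall>R\<in>symbols L. interp N R = interp M R \<inter> tuples L R (universe N))"

text \<open>Maps between structures are extensional functions on the universe of the domain
  (\<^const>\<open>PiE\<close>), so that equality of embeddings is equality on the domain.\<close>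

definition Emb ::
  "'r rel_language \<Rightarrow> ('a, 'r) rel_structure \<Rightarrow> ('b, 'r) rel_structure \<Rightarrow> ('a \<Rightarrow> 'b) set" where
  "Emb L M N = {f \<in> universe M \<rightarrow>\<^sub>E universe N. inj_on f (universe M) \<and>
     (\<forall>R\<in>symbols L. \<forall>xs\<in>tuples L R (universe M). xs \<in> interp M R \<longleftrightarrow> map f xs \<in> interp N R)}"

definition Iso ::
  "'r rel_language \<Rightarrow> ('a, 'r) rel_structure \<Rightarrow> ('b, 'r) rel_structure \<Rightarrow> ('a \<Rightarrow> 'b) set" where
  "Iso L M N = {f \<in> Emb L M N. f ` universe M = universe N}"

definition Aut :: "'r rel_language \<Rightarrow> ('a, 'r) rel_structure \<Rightarrow> ('a \<Rightarrow> 'a) set" where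
  "Aut L M = Iso L M M"

definition ultrahomogeneous :: "'r rel_language \<Rightarrow> ('a, 'r) rel_structure \<Rightarrow> bool" where
  "ultrahomogeneous L K \<longleftrightarrow>
     (\<forall>B C. substructure L B K \<and> finite (universe B) \<and>
            substructure L C K \<and> finite (universe C) \<longrightarrow>
        (\<forall>f\<in>Iso L B C. \<exists>g\<in>Aut L K. \<forall>x\<in>universe B. g x = f x))"

definition fraisse_structure :: "'r rel_language \<Rightarrow> ('a, 'r) rel_structure \<Rightarrow> bool" where
  "fraisse_structure L K \<longleftrightarrow> is_structure L K \<and>
     countable (universe K) \<and> infinite (universe K) \<and> ultrahomogeneous L K"

definition exhaustion ::
  "'r rel_language \<Rightarrow> ('a, 'r) rel_structure \<Rightarrow> (nat \<Rightarrow> ('a, 'r) rel_structure) \<Rightarrow> bool" where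
  "exhaustion L K A \<longleftrightarrow>
     (\<forall>n. substructure L (A n) K \<and> finite (universe (A n))) \<and>
     (\<forall>m n. m \<le> n \<longrightarrow> substructure L (A m) (A n)) \<and>
     universe K = (\<Union>n. universe (A n))"

definition H ::
  "'r rel_language \<Rightarrow> ('a, 'r) rel_structure \<Rightarrow> (nat \<Rightarrow> ('a, 'r) rel_structure)
    \<Rightarrow> nat \<Rightarrow> ('a \<Rightarrow> 'a) set" where
  "H L K A n = Emb L (A n) K"


section \<open>Thick sets\<close>

text \<open>The space \<open>2\<^sup>X\<close> is the power of the discrete space \<^typ>\<open>bool\<close>; its points are
  functions that are extensional on \<open>X\<close>.\<close>

definition cantor_space :: "'x set \<Rightarrow> ('x \<Rightarrow> bool) topology" where
  "cantor_space X = product_topology (\<lambda>_. discrete_topology UNIV) X"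

definition chi :: "'x set \<Rightarrow> 'x set \<Rightarrow> 'x \<Rightarrow> bool" where
  "chi X S = (\<lambda>x\<in>X. x \<in> S)"

definition act ::
  "'r rel_language \<Rightarrow> ('a, 'r) rel_structure \<Rightarrow> (nat \<Rightarrow> ('a, 'r) rel_structure) \<Rightarrow> nat
    \<Rightarrow> (('a \<Rightarrow> 'a) \<Rightarrow> bool) \<Rightarrow> ('a \<Rightarrow> 'a) \<Rightarrow> (('a \<Rightarrow> 'a) \<Rightarrow> bool)" where
  "act L K A m c g = (\<lambda>f\<in>H L K A m. c (compose (universe (A m)) g f))"

definition thick ::
  "'r rel_language \<Rightarrow> ('a, 'r) rel_structure \<Rightarrow> (nat \<Rightarrow> ('a, 'r) rel_structure) \<Rightarrow> nat
    \<Rightarrow> ('a \<Rightarrow> 'a) set \<Rightarrow> bool" where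
  "thick L K A m T \<longleftrightarrow>
     chi (H L K A m) (H L K A m) \<in>
       cantor_space (H L K A m) closure_of
         {act L K A m (chi (H L K A m) T) g | g. g \<in> Aut L K}"


section \<open>The space of ultrafilters on a discrete set\<close>

definition ultrafilter_on :: "'x set \<Rightarrow> 'x set set \<Rightarrow> bool" where
  "ultrafilter_on X p \<longleftrightarrow> p \<subseteq> Pow X \<and> X \<in> p \<and> {} \<notin> p \<and>
     (\<forall>S\<in>p. \<forall>S'\<in>p. S \<inter> S' \<in> p) \<and>
     (\<forall>S\<in>p. \<forall>S'. S \<subseteq> S' \<and> S' \<subseteq> X \<longrightarrow> S' \<in> p) \<and>
     (\<forall>S. S \<subseteq> X \<longrightarrow> S \<in> p \<or> X - S \<in> p)"

definition beta :: "'x set \<Rightarrow> 'x set set set" where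
  "beta X = {p. ultrafilter_on X p}"

definition beta_topology :: "'x set \<Rightarrow> 'x set set topology" where
  "beta_topology X = topology_generated_by {{p \<in> beta X. S \<in> p} | S. S \<subseteq> X}"

definition principal :: "'x set \<Rightarrow> 'x \<Rightarrow> 'x set set" where
  "principal X x = {S. S \<subseteq> X \<and> x \<in> S}"

text \<open>The continuous extension to \<open>\<beta>X \<rightarrow> \<beta>Y\<close> of a map \<open>f : X \<rightarrow> Y\<close> of discrete sets, where
  \<open>X\<close> is identified with the principal ultrafilters. Existence, uniqueness and the
  description as image ultrafilter are shown in \<open>stone_extension_unique_ex\<close> and
  \<open>stone_extension_eq\<close> below.\<close>

definition is_stone_extension ::
  "'x set \<Rightarrow> 'y set \<Rightarrow> ('x \<Rightarrow> 'y) \<Rightarrow> ('x set set \<Rightarrow> 'y set set) \<Rightarrow> bool" where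
  "is_stone_extension X Y f F \<longleftrightarrow> F \<in> extensional (beta X) \<and>
     continuous_map (beta_topology X) (beta_topology Y) F \<and>
     (\<forall>x\<in>X. F (principal X x) = principal Y (f x))"

definition stone_extension ::
  "'x set \<Rightarrow> 'y set \<Rightarrow> ('x \<Rightarrow> 'y) \<Rightarrow> 'x set set \<Rightarrow> 'y set set" where
  "stone_extension X Y f = (THE F. is_stone_extension X Y f F)"

lemma ultrafilter_onD:
  assumes "ultrafilter_on X p"
  shows "S \<in> p \<Longrightarrow> S \<subseteq> X" "X \<in> p" "{} \<notin> p"
    "S \<in> p \<Longrightarrow> S' \<in> p \<Longrightarrow> S \<inter> S' \<in> p"
    "S \<in> p \<Longrightarrow> S \<subseteq> S' \<Longrightarrow> S' \<subseteq> X \<Longrightarrow> S' \<in> p"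
    "S \<subseteq> X \<Longrightarrow> S \<notin> p \<Longrightarrow> X - S \<in> p"
proof -
  have p: "p \<subseteq> Pow X" "X \<in> p" "{} \<notin> p" "\<forall>S\<in>p. \<forall>S'\<in>p. S \<inter> S' \<in> p"
    "\<forall>S\<in>p. \<forall>S'. S \<subseteq> S' \<and> S' \<subseteq> X \<longrightarrow> S' \<in> p" "\<forall>S. S \<subseteq> X \<longrightarrow> S \<in> p \<or> X - S \<in> p"
    using assms[unfolded ultrafilter_on_def] by - (elim conjE, assumption)+
  show "S \<in> p \<Longrightarrow> S \<subseteq> X" using p(1) by blast
  show "X \<in> p" "{} \<notin> p" by (fact p)+
  show "S \<in> p \<Longrightarrow> S' \<in> p \<Longrightarrow> S \<inter> S' \<in> p" using p(4) by simp
  show "S \<in> p \<Longrightarrow> S \<subseteq> S' \<Longrightarrow> S' \<subseteq> X \<Longrightarrow> S' \<in> p" using p(5) by metis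
  show "S \<subseteq> X \<Longrightarrow> S \<notin> p \<Longrightarrow> X - S \<in> p" using p(6) by metis
qed

lemma ultrafilter_onI:
  assumes "p \<subseteq> Pow X" "X \<in> p" "{} \<notin> p"
    "\<And>S S'. S \<in> p \<Longrightarrow> S' \<in> p \<Longrightarrow> S \<inter> S' \<in> p"
    "\<And>S S'. S \<in> p \<Longrightarrow> S \<subseteq> S' \<Longrightarrow> S' \<subseteq> X \<Longrightarrow> S' \<in> p"
    "\<And>S. S \<subseteq> X \<Longrightarrow> S \<in> p \<or> X - S \<in> p"
  shows "ultrafilter_on X p"
  unfolding ultrafilter_on_def
  by (intro conjI ballI allI impI; (elim conjE)?) (rule assms; assumption)+

lemma topspace_beta [simp]: "topspace (beta_topology X) = beta X"
proof -
  have "\<Union>{{p \<in> beta X. S \<in> p} | S. S \<subseteq> X} = beta X"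
    by (auto simp: beta_def ultrafilter_on_def)
  then show ?thesis by (simp add: beta_topology_def)
qed

lemma principal_in_beta: "x \<in> X \<Longrightarrow> principal X x \<in> beta X"
  by (auto simp: beta_def principal_def ultrafilter_on_def)

lemma openin_beta_nhd:
  assumes "openin (beta_topology X) W" "p \<in> W"
  obtains S where "S \<in> p" "S \<subseteq> X" "{q \<in> beta X. S \<in> q} \<subseteq> W"
proof -
  have "p \<in> beta X"
    using openin_subset[OF assms(1)] assms(2) by auto
  then have p: "ultrafilter_on X p" by (simp add: beta_def)
  have "generate_topology_on {{p \<in> beta X. S \<in> p} | S. S \<subseteq> X} W"
    using assms(1) by (simp add: beta_topology_def openin_topology_generated_by_iff)
  then have "\<exists>S\<in>p. S \<subseteq> X \<and> {q \<in> beta X. S \<in> q} \<subseteq> W" using assms(2)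
  proof (induction rule: generate_topology_on.induct)
    case (Int a b)
    from Int.IH(1) Int.prems obtain S
      where S: "S \<in> p" "S \<subseteq> X" "{q \<in> beta X. S \<in> q} \<subseteq> a" by (elim IntE) metis
    from Int.IH(2) Int.prems obtain S'
      where S': "S' \<in> p" "S' \<subseteq> X" "{q \<in> beta X. S' \<in> q} \<subseteq> b" by (elim IntE) metis
    have "S \<in> q \<and> S' \<in> q" if "q \<in> beta X" "S \<inter> S' \<in> q" for q
    proof -
      have q: "ultrafilter_on X q" using that by (simp add: beta_def)
      show ?thesis
        using ultrafilter_onD(5)[OF q that(2)] S(2) S'(2) by simp
    qed
    then have "{q \<in> beta X. S \<inter> S' \<in> q} \<subseteq> a \<inter> b" using S(3) S'(3) by auto
    moreover have "S \<inter> S' \<in> p" by (rule ultrafilter_onD(4)[OF p S(1) S'(1)])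
    moreover have "S \<inter> S' \<subseteq> X" using S(2) by auto
    ultimately show ?case by (intro bexI conjI)
  next
    case (UN K)
    then obtain k where k: "k \<in> K" "p \<in> k" by (elim UnionE)
    from UN.IH[OF this] obtain S where "S \<in> p" "S \<subseteq> X \<and> {q \<in> beta X. S \<in> q} \<subseteq> k" ..
    moreover from this have "{q \<in> beta X. S \<in> q} \<subseteq> \<Union>K"
      using Union_upper[OF k(1)] by (meson subset_trans)
    ultimately show ?case by (intro bexI[of _ S]) simp_all
  next
    case (Basis s)
    then obtain S where S: "s = {q \<in> beta X. S \<in> q}" "S \<subseteq> X" by (simp only: mem_Collect_eq) (elim exE conjE)
    then show ?case using Basis(2) by (intro bexI[of _ S]) simp_all
  qed simp
  then show thesis using that by (elim bexE conjE)
qed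

lemma image_ultrafilter_in_beta:
  assumes f: "f \<in> X \<rightarrow> Y" and "p \<in> beta X"
  shows "{S. S \<subseteq> Y \<and> {x \<in> X. f x \<in> S} \<in> p} \<in> beta Y"
proof -
  have p: "ultrafilter_on X p" using assms by (simp add: beta_def)
  let ?q = "{S. S \<subseteq> Y \<and> {x \<in> X. f x \<in> S} \<in> p}"
  have "?q \<subseteq> Pow Y" by blast
  moreover have "Y \<in> ?q"
  proof -
    have "{x \<in> X. f x \<in> Y} = X" using f by auto
    then show ?thesis using ultrafilter_onD(2)[OF p] by simp
  qed
  moreover have "{} \<notin> ?q" using ultrafilter_onD(3)[OF p] by simp
  moreover have "S \<inter> S' \<in> ?q" if "S \<in> ?q" "S' \<in> ?q" for S S'
  proof -
    have "{x \<in> X. f x \<in> S \<inter> S'} = {x \<in> X. f x \<in> S} \<inter> {x \<in> X. f x \<in> S'}" by auto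
    then show ?thesis using that ultrafilter_onD(4)[OF p] by auto
  qed
  moreover have "S' \<in> ?q" if "S \<in> ?q" "S \<subseteq> S'" "S' \<subseteq> Y" for S S'
  proof -
    have "{x \<in> X. f x \<in> S'} \<in> p"
      by (rule ultrafilter_onD(5)[OF p, of "{x \<in> X. f x \<in> S}"]) (use that in auto)
    then show ?thesis using that by simp
  qed
  moreover have "S \<in> ?q \<or> Y - S \<in> ?q" if "S \<subseteq> Y" for S
  proof -
    have "{x \<in> X. f x \<in> Y - S} = X - {x \<in> X. f x \<in> S}" using f by auto
    then show ?thesis using that ultrafilter_onD(6)[OF p, of "{x \<in> X. f x \<in> S}"] by auto
  qed
  ultimately have "ultrafilter_on Y ?q" by (rule ultrafilter_onI)
  then show ?thesis by (simp add: beta_def)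
qed

lemma is_stone_extension_image:
  assumes f: "f \<in> X \<rightarrow> Y"
  shows "is_stone_extension X Y f (\<lambda>p\<in>beta X. {S. S \<subseteq> Y \<and> {x \<in> X. f x \<in> S} \<in> p})"
    (is "is_stone_extension X Y f ?F")
proof -
  have F: "?F \<in> beta X \<rightarrow> beta Y"
    using image_ultrafilter_in_beta[OF f] by auto
  have "continuous_map (beta_topology X) (beta_topology Y) ?F"
    unfolding beta_topology_def[of Y]
  proof (rule continuous_on_generated_topo)
    fix U assume "U \<in> {{p \<in> beta Y. S \<in> p} | S. S \<subseteq> Y}"
    then obtain S where S: "S \<subseteq> Y" "U = {p \<in> beta Y. S \<in> p}" by blast
    have "?F -` U \<inter> topspace (beta_topology X) = {p \<in> beta X. {x \<in> X. f x \<in> S} \<in> p}"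
      using S image_ultrafilter_in_beta[OF f] by auto
    moreover have "openin (beta_topology X) {p \<in> beta X. {x \<in> X. f x \<in> S} \<in> p}"
      unfolding beta_topology_def by (rule topology_generated_by_Basis) blast
    ultimately show "openin (beta_topology X) (?F -` U \<inter> topspace (beta_topology X))" by simp
  next
    have "\<Union>{{p \<in> beta Y. S \<in> p} | S. S \<subseteq> Y} = beta Y"
      by (auto simp: beta_def ultrafilter_on_def)
    then show "?F ` topspace (beta_topology X) \<subseteq> \<Union>{{p \<in> beta Y. S \<in> p} | S. S \<subseteq> Y}"
      using F image_subset_iff_funcset[of ?F "beta X" "beta Y"] by (simp only: topspace_beta)
  qed
  moreover have "\<forall>x\<in>X. ?F (principal X x) = principal Y (f x)"
    by (auto simp: principal_in_beta) (auto simp: principal_def)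
  ultimately show ?thesis by (simp add: is_stone_extension_def)
qed

lemma is_stone_extension_imp_image:
  assumes f: "f \<in> X \<rightarrow> Y" and F: "is_stone_extension X Y f F" and p: "p \<in> beta X"
  shows "F p = {S. S \<subseteq> Y \<and> {x \<in> X. f x \<in> S} \<in> p}"
proof -
  have cont: "continuous_map (beta_topology X) (beta_topology Y) F"
    and princ: "\<And>x. x \<in> X \<Longrightarrow> F (principal X x) = principal Y (f x)"
    using F by (auto simp: is_stone_extension_def)
  have up: "ultrafilter_on X p" using p by (simp add: beta_def)
  have "F p \<in> beta Y" using cont p by (auto simp: continuous_map_def)
  then have uF: "ultrafilter_on Y (F p)" by (simp add: beta_def)
  have sub: "{x \<in> X. f x \<in> S} \<in> p" if S: "S \<in> F p" for S
  proof (rule ccontr)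
    assume "{x \<in> X. f x \<in> S} \<notin> p"
    then have C: "X - {x \<in> X. f x \<in> S} \<in> p" by (intro ultrafilter_onD(6)[OF up]) auto
    have "S \<subseteq> Y" using ultrafilter_onD(1)[OF uF S] .
    then have "openin (beta_topology Y) {q \<in> beta Y. S \<in> q}"
      unfolding beta_topology_def by (intro topology_generated_by_Basis) blast
    then have "openin (beta_topology X) {r \<in> topspace (beta_topology X). F r \<in> {q \<in> beta Y. S \<in> q}}"
      using cont openin_continuous_map_preimage by blast
    moreover have "p \<in> {r \<in> topspace (beta_topology X). F r \<in> {q \<in> beta Y. S \<in> q}}"
      using p S \<open>F p \<in> beta Y\<close> by simp
    ultimately obtain S' where S': "S' \<in> p" "S' \<subseteq> X" "{r \<in> beta X. S' \<in> r} \<subseteq>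
        {r \<in> topspace (beta_topology X). F r \<in> {q \<in> beta Y. S \<in> q}}"
      by (rule openin_beta_nhd)
    have "S' \<inter> (X - {x \<in> X. f x \<in> S}) \<noteq> {}"
      using ultrafilter_onD(4)[OF up S'(1) C] ultrafilter_onD(3)[OF up] by metis
    then obtain x where x: "x \<in> S'" "x \<in> X" "f x \<notin> S" by blast
    have "S' \<in> principal X x" using x S' by (simp add: principal_def)
    then have "S \<in> F (principal X x)" using S'(3) principal_in_beta[OF x(2)] by auto
    then show False using princ[OF x(2)] x by (simp add: principal_def)
  qed
  show ?thesis
  proof (intro equalityI subsetI)
    fix S assume "S \<in> F p"
    then show "S \<in> {S. S \<subseteq> Y \<and> {x \<in> X. f x \<in> S} \<in> p}"
      using sub[of S] ultrafilter_onD(1)[OF uF, of S] by simp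
  next
    fix S assume S: "S \<in> {S. S \<subseteq> Y \<and> {x \<in> X. f x \<in> S} \<in> p}"
    show "S \<in> F p"
    proof (rule ccontr)
      assume "S \<notin> F p"
      then have "Y - S \<in> F p" using S by (intro ultrafilter_onD(6)[OF uF]) auto
      then have "{x \<in> X. f x \<in> Y - S} \<in> p" by (rule sub)
      moreover have "{x \<in> X. f x \<in> S} \<in> p" using S by blast
      ultimately have "{x \<in> X. f x \<in> Y - S} \<inter> {x \<in> X. f x \<in> S} \<in> p"
        by (rule ultrafilter_onD(4)[OF up])
      moreover have "{x \<in> X. f x \<in> Y - S} \<inter> {x \<in> X. f x \<in> S} = {}" by auto
      ultimately show False using ultrafilter_onD(3)[OF up] by simp
    qed
  qed
qed

lemma stone_extension_unique_ex:
  assumes f: "f \<in> X \<rightarrow> Y"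
  shows "\<exists>!F. is_stone_extension X Y f F"
proof (rule ex1I)
  show "is_stone_extension X Y f (\<lambda>p\<in>beta X. {S. S \<subseteq> Y \<and> {x \<in> X. f x \<in> S} \<in> p})"
    by (rule is_stone_extension_image[OF f])
next
  fix F assume F: "is_stone_extension X Y f F"
  then have ext: "F \<in> extensional (beta X)" by (simp add: is_stone_extension_def)
  show "F = (\<lambda>p\<in>beta X. {S. S \<subseteq> Y \<and> {x \<in> X. f x \<in> S} \<in> p})"
  proof (rule extensionalityI[OF ext restrict_extensional])
    fix p assume p: "p \<in> beta X"
    show "F p = (\<lambda>p\<in>beta X. {S. S \<subseteq> Y \<and> {x \<in> X. f x \<in> S} \<in> p}) p"
      unfolding restrict_apply'[OF p] by (rule is_stone_extension_imp_image[OF f F p])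
  qed
qed

lemma stone_extension_eq:
  assumes f: "f \<in> X \<rightarrow> Y" and p: "p \<in> beta X"
  shows "stone_extension X Y f p = {S. S \<subseteq> Y \<and> {x \<in> X. f x \<in> S} \<in> p}"
proof -
  have "is_stone_extension X Y f (stone_extension X Y f)"
    unfolding stone_extension_def by (rule theI'[OF stone_extension_unique_ex[OF f]])
  from is_stone_extension_imp_image[OF f this p] show ?thesis .
qed


section \<open>The semigroup \<open>S(G)\<close>\<close>

definition restr ::
  "'r rel_language \<Rightarrow> ('a, 'r) rel_structure \<Rightarrow> (nat \<Rightarrow> ('a, 'r) rel_structure)
    \<Rightarrow> nat \<Rightarrow> nat \<Rightarrow> ('a \<Rightarrow> 'a) set set \<Rightarrow> ('a \<Rightarrow> 'a) set set" where
  "restr L K A n m =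
     stone_extension (H L K A n) (H L K A m) (\<lambda>x. restrict x (universe (A m)))"

definition SG ::
  "'r rel_language \<Rightarrow> ('a, 'r) rel_structure \<Rightarrow> (nat \<Rightarrow> ('a, 'r) rel_structure)
    \<Rightarrow> (nat \<Rightarrow> ('a \<Rightarrow> 'a) set set) set" where
  "SG L K A = {\<alpha>. (\<forall>n. \<alpha> n \<in> beta (H L K A n)) \<and>
     (\<forall>m n. m \<le> n \<longrightarrow> restr L K A n m (\<alpha> n) = \<alpha> m)}"

text \<open>\<open>dot_at L K A n \<alpha> m f\<close> is \<open>\<alpha> \<cdot> f\<close> (for \<open>f\<close> in \<open>H\<^sub>m\<close>) computed from the coordinate
  \<open>\<alpha>(n)\<close>; \<open>dot\<close> uses the least admissible \<open>n\<close>. By \<open>dot_eq_dot_at\<close> every admissible \<open>n\<close>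
  gives the same result.\<close>

definition dot_at ::
  "'r rel_language \<Rightarrow> ('a, 'r) rel_structure \<Rightarrow> (nat \<Rightarrow> ('a, 'r) rel_structure) \<Rightarrow> nat
    \<Rightarrow> (nat \<Rightarrow> ('a \<Rightarrow> 'a) set set) \<Rightarrow> nat \<Rightarrow> ('a \<Rightarrow> 'a) \<Rightarrow> ('a \<Rightarrow> 'a) set set" where
  "dot_at L K A n \<alpha> m f =
     {S. S \<subseteq> H L K A m \<and> {x \<in> H L K A n. compose (universe (A m)) x f \<in> S} \<in> \<alpha> n}"

definition dot ::
  "'r rel_language \<Rightarrow> ('a, 'r) rel_structure \<Rightarrow> (nat \<Rightarrow> ('a, 'r) rel_structure)
    \<Rightarrow> (nat \<Rightarrow> ('a \<Rightarrow> 'a) set set) \<Rightarrow> nat \<Rightarrow> ('a \<Rightarrow> 'a) \<Rightarrow> ('a \<Rightarrow> 'a) set set" where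
  "dot L K A \<alpha> m f =
     dot_at L K A (LEAST n. m \<le> n \<and> f ` universe (A m) \<subseteq> universe (A n)) \<alpha> m f"

definition SG_mult ::
  "'r rel_language \<Rightarrow> ('a, 'r) rel_structure \<Rightarrow> (nat \<Rightarrow> ('a, 'r) rel_structure)
    \<Rightarrow> (nat \<Rightarrow> ('a \<Rightarrow> 'a) set set) \<Rightarrow> (nat \<Rightarrow> ('a \<Rightarrow> 'a) set set)
    \<Rightarrow> (nat \<Rightarrow> ('a \<Rightarrow> 'a) set set)" where
  "SG_mult L K A \<alpha> \<gamma> =
     (\<lambda>m. {S. S \<subseteq> H L K A m \<and> {f \<in> H L K A m. S \<in> dot L K A \<alpha> m f} \<in> \<gamma> m})"

definition right_ideal ::
  "'r rel_language \<Rightarrow> ('a, 'r) rel_structure \<Rightarrow> (nat \<Rightarrow> ('a, 'r) rel_structure)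
    \<Rightarrow> (nat \<Rightarrow> ('a \<Rightarrow> 'a) set set) set \<Rightarrow> bool" where
  "right_ideal L K A I \<longleftrightarrow> I \<noteq> {} \<and> I \<subseteq> SG L K A \<and>
     (\<forall>\<alpha>\<in>I. \<forall>\<gamma>\<in>SG L K A. SG_mult L K A \<alpha> \<gamma> \<in> I)"

definition minimal_right_ideal ::
  "'r rel_language \<Rightarrow> ('a, 'r) rel_structure \<Rightarrow> (nat \<Rightarrow> ('a, 'r) rel_structure)
    \<Rightarrow> (nat \<Rightarrow> ('a \<Rightarrow> 'a) set set) set \<Rightarrow> bool" where
  "minimal_right_ideal L K A I \<longleftrightarrow> right_ideal L K A I \<and>
     (\<forall>J. right_ideal L K A J \<and> J \<subseteq> I \<longrightarrow> J = I)"

definition tilde ::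
  "'r rel_language \<Rightarrow> ('a, 'r) rel_structure \<Rightarrow> (nat \<Rightarrow> ('a, 'r) rel_structure)
    \<Rightarrow> nat \<Rightarrow> ('a \<Rightarrow> 'a) set \<Rightarrow> (nat \<Rightarrow> ('a \<Rightarrow> 'a) set set) set" where
  "tilde L K A m T = {\<alpha> \<in> SG L K A. T \<in> \<alpha> m}"

lemma Emb_restrict:
  assumes "x \<in> Emb L M K" "substructure L N M"
  shows "restrict x (universe N) \<in> Emb L N K"
proof -
  have sub: "universe N \<subseteq> universe M" using assms(2) by (simp add: substructure_def)
  have "xs \<in> interp N R \<longleftrightarrow> map (restrict x (universe N)) xs \<in> interp K R"
    if R: "R \<in> symbols L" and xs: "xs \<in> tuples L R (universe N)" for R xs
  proof -
    have eq: "map (restrict x (universe N)) xs = map x xs"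
      using xs by (auto simp: tuples_def)
    have "xs \<in> tuples L R (universe M)" using xs sub by (auto simp: tuples_def)
    then have "xs \<in> interp M R \<longleftrightarrow> map x xs \<in> interp K R"
      using assms(1) R by (auto simp: Emb_def)
    moreover have "xs \<in> interp N R \<longleftrightarrow> xs \<in> interp M R"
      using assms(2) R xs by (auto simp: substructure_def)
    ultimately show ?thesis unfolding eq by simp
  qed
  moreover have "inj_on (restrict x (universe N)) (universe N)"
    using assms(1) inj_on_subset[OF _ sub] by (auto simp: Emb_def inj_on_restrict_eq)
  moreover have "restrict x (universe N) \<in> universe N \<rightarrow>\<^sub>E universe K"
    using assms(1) sub by (auto simp: Emb_def)
  ultimately show ?thesis by (auto simp: Emb_def)
qed

lemma dot_eq_dot_at:
  assumes ex: "exhaustion L K A" and \<alpha>: "\<alpha> \<in> SG L K A" and f: "f \<in> H L K A m"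
    and n: "m \<le> n" "f ` universe (A m) \<subseteq> universe (A n)"
  shows "dot L K A \<alpha> m f = dot_at L K A n \<alpha> m f"
proof -
  define k where "k = (LEAST n. m \<le> n \<and> f ` universe (A m) \<subseteq> universe (A n))"
  have k: "f ` universe (A m) \<subseteq> universe (A k)" "k \<le> n"
    unfolding k_def
    using LeastI[of "\<lambda>n. m \<le> n \<and> f ` universe (A m) \<subseteq> universe (A n)" n]
      Least_le[of "\<lambda>n. m \<le> n \<and> f ` universe (A m) \<subseteq> universe (A n)" n] n by auto
  have sub: "substructure L (A k) (A n)" using ex k(2) by (simp add: exhaustion_def)
  have r: "(\<lambda>x. restrict x (universe (A k))) \<in> H L K A n \<rightarrow> H L K A k"
    using Emb_restrict[OF _ sub] by (auto simp: H_def)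
  have "\<alpha> k = stone_extension (H L K A n) (H L K A k) (\<lambda>x. restrict x (universe (A k))) (\<alpha> n)"
    using \<alpha> k(2) by (simp add: SG_def restr_def)
  also have "\<dots> = {S. S \<subseteq> H L K A k \<and> {x \<in> H L K A n. restrict x (universe (A k)) \<in> S} \<in> \<alpha> n}"
    using \<alpha> by (intro stone_extension_eq[OF r]) (simp add: SG_def)
  finally have \<alpha>k: "\<alpha> k = \<dots>" .
  have "compose (universe (A m)) (restrict x (universe (A k))) f = compose (universe (A m)) x f"
    if "x \<in> H L K A n" for x
    using k(1) by (auto simp: compose_def restrict_def fun_eq_iff)
  then have "{x \<in> H L K A n. restrict x (universe (A k)) \<in> {x \<in> H L K A k. compose (universe (A m)) x f \<in> S}}
      = {x \<in> H L K A n. compose (universe (A m)) x f \<in> S}" for S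
    using r by auto
  then show ?thesis
    by (auto simp: dot_def dot_at_def k_def[symmetric] \<alpha>k)
qed

end

theory Submission
  imports Defs
begin

text \<open>
  Everything rests on a third condition, on a single point of \<open>S(G)\<close>: there is
  \<open>\<alpha> \<in> S(G)\<close> with \<open>T \<in> \<alpha> \<cdot> f\<close> for all \<open>f \<in> H\<^sub>m\<close>.

  This condition is thickness. Thickness says that every finite \<open>F \<subseteq> H\<^sub>m\<close> is moved into \<open>T\<close>
  by some automorphism \<open>g\<close>. An automorphism is a point of \<open>S(G)\<close>, given by the principal
  ultrafilters at its restrictions, so compactness of \<open>S(G)\<close> turns the automorphisms for the
  various \<open>F\<close> into one \<open>\<alpha>\<close> that serves all \<open>f\<close> at once. Conversely, for finite \<open>F\<close> and large
  \<open>n\<close> the ultrafilter \<open>\<alpha>(n)\<close> contains the set of those \<open>x \<in> H\<^sub>n\<close> with \<open>x \<circ> f \<in> T\<close> for all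
  \<open>f \<in> F\<close>, so there is such an \<open>x\<close>, and it extends to an automorphism by ultrahomogeneity
  (lemma \<open>thick_iff_point\<close>).

  The condition also says that \<open>\<alpha> S(G)\<close> lies in the set of points that contain \<open>T\<close>. By the
  definition of the product, that inclusion says that \<open>{f. T \<in> \<alpha> \<cdot> f}\<close> belongs to \<open>\<gamma>(m)\<close> for
  every \<open>\<gamma>\<close>; as every \<open>f \<in> H\<^sub>m\<close> extends to an automorphism, all principal ultrafilters occur
  as \<open>\<gamma>(m)\<close>, so the set must be all of \<open>H\<^sub>m\<close> (lemma \<open>all_translates_iff\<close>). Finally \<open>\<alpha> S(G)\<close> is
  a closed right ideal, hence contains a minimal right ideal, and a minimal right ideal
  contains \<open>\<alpha> S(G)\<close> for each of its points \<open>\<alpha>\<close>.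

  The topology of \<open>S(G)\<close> enters only through closed sets and compactness. Both are
  handled by limits of ultrafilters on the set \<open>S(G)\<close>: the limit of such an ultrafilter
  contains \<open>Q\<close> in its coordinate \<open>n\<close> iff almost all points of \<open>S(G)\<close> do.
\<close>

section \<open>Ultrafilters\<close>

text \<open>A maximal filter base above the given one is already an ultrafilter. If all its
  members meet a set \<open>S\<close>, then the supersets of their traces on \<open>S\<close> form a filter base above it,
  which by maximality adds nothing, so \<open>S\<close> is a member; if some member misses \<open>S\<close>, then the
  complement of \<open>S\<close> is a member. The case that \<open>S\<close> is everything gives closure under supersets.\<close>

lemma filter_base_extends_to_ultrafilter:
  assumes "\<F> \<subseteq> Pow X" "\<F> \<noteq> {}" "{} \<notin> \<F>"
    and "\<And>B C. B \<in> \<F> \<Longrightarrow> C \<in> \<F> \<Longrightarrow> \<exists>D\<in>\<F>. D \<subseteq> B \<inter> C"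
  obtains W where "ultrafilter_on X W" "\<F> \<subseteq> W"
proof -
  define Z where "Z = {\<G>. \<F> \<subseteq> \<G> \<and> \<G> \<subseteq> Pow X \<and> {} \<notin> \<G> \<and>
    (\<forall>B\<in>\<G>. \<forall>C\<in>\<G>. \<exists>D\<in>\<G>. D \<subseteq> B \<inter> C)}"
  have "\<F> \<in> Z" using assms by (auto simp: Z_def)
  have "\<exists>M\<in>Z. \<forall>\<G>\<in>Z. M \<subseteq> \<G> \<longrightarrow> \<G> = M"
  proof (rule subset_Zorn_nonempty)
    show "Z \<noteq> {}" using \<open>\<F> \<in> Z\<close> by auto
  next
    fix \<C> assume \<C>: "\<C> \<noteq> {}" "subset.chain Z \<C>"
    have "\<C> \<subseteq> Z" using \<C>(2) by (simp add: subset_chain_def)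
    have "\<exists>D\<in>\<Union>\<C>. D \<subseteq> B \<inter> C" if B: "B \<in> \<Union>\<C>" and C: "C \<in> \<Union>\<C>" for B C
    proof -
      obtain \<G> where "\<G> \<in> \<C>" "B \<in> \<G>" "C \<in> \<G>"
      proof -
        obtain \<G>1 \<G>2 where "\<G>1 \<in> \<C>" "B \<in> \<G>1" "\<G>2 \<in> \<C>" "C \<in> \<G>2" using B C by auto
        moreover have "\<G>1 \<subseteq> \<G>2 \<or> \<G>2 \<subseteq> \<G>1"
          using calculation \<C>(2) by (auto simp: subset_chain_def)
        ultimately show thesis using that by blast
      qed
      moreover have "\<G> \<in> Z" using calculation \<open>\<C> \<subseteq> Z\<close> by auto
      ultimately have "\<exists>D\<in>\<G>. D \<subseteq> B \<inter> C" by (simp add: Z_def)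
      then show ?thesis using \<open>\<G> \<in> \<C>\<close> by blast
    qed
    moreover have mem: "\<F> \<subseteq> \<G>" "\<G> \<subseteq> Pow X" "{} \<notin> \<G>" if "\<G> \<in> \<C>" for \<G>
      using subsetD[OF \<open>\<C> \<subseteq> Z\<close> that] by (simp_all add: Z_def)
    have "\<F> \<subseteq> \<Union>\<C>" using mem(1) \<C>(1) by auto
    moreover have "\<Union>\<C> \<subseteq> Pow X" by (rule Union_least) (rule mem(2))
    moreover have "{} \<notin> \<Union>\<C>" using mem(3) by auto
    ultimately show "\<Union>\<C> \<in> Z" unfolding Z_def by simp
  qed
  then obtain M where M: "M \<in> Z" and max: "\<And>\<G>. \<G> \<in> Z \<Longrightarrow> M \<subseteq> \<G> \<Longrightarrow> \<G> = M" by blast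
  have sub: "\<F> \<subseteq> M" "M \<subseteq> Pow X" and ne: "{} \<notin> M"
    and dir: "\<And>B C. B \<in> M \<Longrightarrow> C \<in> M \<Longrightarrow> \<exists>D\<in>M. D \<subseteq> B \<inter> C"
    using M by (auto simp: Z_def)
  have enlarge: "Q \<in> M" if S: "\<forall>B\<in>M. B \<inter> S \<noteq> {}" and Q: "B0 \<in> M" "B0 \<inter> S \<subseteq> Q" "Q \<subseteq> X" for S B0 Q
  proof -
    let ?G = "{Q. Q \<subseteq> X \<and> (\<exists>B\<in>M. B \<inter> S \<subseteq> Q)}"
    have "M \<subseteq> ?G" using sub by blast
    moreover have "\<exists>D\<in>?G. D \<subseteq> B \<inter> C" if BC: "B \<in> ?G" "C \<in> ?G" for B C
    proof -
      obtain B' C' where B': "B' \<in> M" "B' \<inter> S \<subseteq> B" and C': "C' \<in> M" "C' \<inter> S \<subseteq> C"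
        using BC by auto
      obtain D where D: "D \<in> M" "D \<subseteq> B' \<inter> C'" using dir[OF B'(1) C'(1)] by auto
      have "D \<inter> S \<subseteq> B \<inter> C" using B'(2) C'(2) D(2) by auto
      moreover have "B \<inter> C \<subseteq> X" using BC(1) by auto
      ultimately have "B \<inter> C \<in> ?G" using D(1) by auto
      then show ?thesis by (rule bexI[rotated]) simp
    qed
    ultimately have "?G \<in> Z" using S sub(1) by (auto simp: Z_def)
    then have "?G = M" using max \<open>M \<subseteq> ?G\<close> by blast
    then show ?thesis using Q by blast
  qed
  have up: "Q \<in> M" if "B \<in> M" "B \<subseteq> Q" "Q \<subseteq> X" for B Q
    using enlarge[of UNIV B Q] that ne by auto
  have "ultrafilter_on X M"
  proof (rule ultrafilter_onI)
    obtain B where "B \<in> M" using assms(2) sub(1) by auto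
    moreover have "B \<subseteq> X" using calculation sub(2) by auto
    ultimately show "X \<in> M" using up[of B X] by simp
    show "B \<inter> C \<in> M" if BC: "B \<in> M" "C \<in> M" for B C
    proof -
      obtain D where "D \<in> M" "D \<subseteq> B \<inter> C" using dir[OF BC] by auto
      moreover have "B \<inter> C \<subseteq> X" using BC sub(2) by auto
      ultimately show ?thesis by (rule up)
    qed
    show "S \<in> M \<or> X - S \<in> M" if "S \<subseteq> X" for S
    proof (cases "\<forall>B\<in>M. B \<inter> S \<noteq> {}")
      case True
      then have "S \<in> M" using \<open>X \<in> M\<close> by (rule enlarge) (use that in auto)
      then show ?thesis ..
    next
      case False
      then obtain B where "B \<in> M" "B \<inter> S = {}" by blast
      moreover have "B \<subseteq> X - S" using calculation sub(2) by auto
      ultimately have "X - S \<in> M" using up[of B "X - S"] by simp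
      then show ?thesis ..
    qed
  qed (use sub ne up in auto)
  then show thesis using that sub(1) by blast
qed

lemma in_beta_ultrafilter: "p \<in> beta X \<Longrightarrow> ultrafilter_on X p"
  by (simp add: beta_def)

lemmas in_betaD = ultrafilter_onD[OF in_beta_ultrafilter]

lemma ultrafilter_subset_eq:
  assumes "p \<in> beta X" "q \<in> beta X" "p \<subseteq> q"
  shows "p = q"
proof (rule equalityI[OF assms(3)], rule subsetI)
  fix S assume "S \<in> q"
  show "S \<in> p"
  proof (rule ccontr)
    assume "S \<notin> p"
    then have "X - S \<in> p" using in_betaD(6)[OF assms(1)] in_betaD(1)[OF assms(2) \<open>S \<in> q\<close>] by blast
    then have "(X - S) \<inter> S \<in> q" using in_betaD(4)[OF assms(2)] \<open>S \<in> q\<close> assms(3) by blast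
    moreover have "(X - S) \<inter> S = {}" by blast
    ultimately show False using in_betaD(3)[OF assms(2)] by simp
  qed
qed

text \<open>The limit of the points \<open>p i\<close> of \<open>\<beta>Y\<close> along an ultrafilter \<open>q\<close> on the index set. Both the
  product of \<open>S(G)\<close> and the limits that express its compactness have this shape.\<close>

lemma ultrafilter_limit_in_beta:
  assumes p: "\<And>i. i \<in> X \<Longrightarrow> p i \<in> beta Y" and q: "q \<in> beta X"
  shows "{S. S \<subseteq> Y \<and> {i \<in> X. S \<in> p i} \<in> q} \<in> beta Y"
proof -
  let ?r = "{S. S \<subseteq> Y \<and> {i \<in> X. S \<in> p i} \<in> q}"
  have "ultrafilter_on Y ?r"
  proof (rule ultrafilter_onI)
    have "{i \<in> X. Y \<in> p i} = X" using in_betaD(2)[OF p] by auto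
    then show "Y \<in> ?r" using in_betaD(2)[OF q] by simp
    have "{i \<in> X. {} \<in> p i} = {}" using in_betaD(3)[OF p] by auto
    then show "{} \<notin> ?r" using in_betaD(3)[OF q] by (simp only: mem_Collect_eq simp_thms)
  next
    fix S S' assume S: "S \<in> ?r" "S' \<in> ?r"
    then have "{i \<in> X. S \<in> p i} \<inter> {i \<in> X. S' \<in> p i} \<in> q" using in_betaD(4)[OF q] by auto
    moreover have "{i \<in> X. S \<in> p i} \<inter> {i \<in> X. S' \<in> p i} \<subseteq> {i \<in> X. S \<inter> S' \<in> p i}"
      using in_betaD(4)[OF p] by auto
    ultimately have "{i \<in> X. S \<inter> S' \<in> p i} \<in> q" by (rule in_betaD(5)[OF q]) auto
    then show "S \<inter> S' \<in> ?r" using S by blast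
  next
    fix S S' assume S: "S \<in> ?r" "S \<subseteq> S'" "S' \<subseteq> Y"
    have "{i \<in> X. S \<in> p i} \<in> q" using S(1) by blast
    moreover have "{i \<in> X. S \<in> p i} \<subseteq> {i \<in> X. S' \<in> p i}" using in_betaD(5)[OF p _ S(2,3)] by blast
    ultimately have "{i \<in> X. S' \<in> p i} \<in> q" by (rule in_betaD(5)[OF q]) blast
    then show "S' \<in> ?r" using S(3) by blast
  next
    fix S assume S: "S \<subseteq> Y"
    show "S \<in> ?r \<or> Y - S \<in> ?r"
    proof (cases "{i \<in> X. S \<in> p i} \<in> q")
      case False
      then have "X - {i \<in> X. S \<in> p i} \<in> q" by (intro in_betaD(6)[OF q]) auto
      moreover have "X - {i \<in> X. S \<in> p i} \<subseteq> {i \<in> X. Y - S \<in> p i}" using S in_betaD(6)[OF p] by auto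
      ultimately have "{i \<in> X. Y - S \<in> p i} \<in> q" by (rule in_betaD(5)[OF q]) auto
      then show ?thesis by auto
    qed (use S in auto)
  qed auto
  then show ?thesis by (simp add: beta_def)
qed


section \<open>Embeddings into an ultrahomogeneous structure\<close>

locale fraisse_exhaustion =
  fixes L :: "'r rel_language"
    and K :: "('a, 'r) rel_structure"
    and A :: "nat \<Rightarrow> ('a, 'r) rel_structure"
  assumes fraisse: "fraisse_structure L K"
    and exh: "exhaustion L K A"
begin

abbreviation E :: "nat \<Rightarrow> ('a \<Rightarrow> 'a) set" where
  "E n \<equiv> H L K A n"

abbreviation U :: "nat \<Rightarrow> 'a set" where
  "U n \<equiv> universe (A n)"

lemma substructure_K: "substructure L (A n) K"
  and finite_U: "finite (U n)"
  and substructure_mono: "m \<le> n \<Longrightarrow> substructure L (A m) (A n)"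
  and universe_K: "universe K = (\<Union>n. U n)"
  using exh by (auto simp: exhaustion_def)

lemma U_mono: "m \<le> n \<Longrightarrow> U m \<subseteq> U n"
  using substructure_mono by (simp add: substructure_def)

lemma E_image: "f \<in> E m \<Longrightarrow> f ` U m \<subseteq> universe K"
  by (auto simp: H_def Emb_def)

lemma E_restrict: "m \<le> n \<Longrightarrow> x \<in> E n \<Longrightarrow> restrict x (U m) \<in> E m"
  using Emb_restrict[OF _ substructure_mono] by (simp add: H_def)

lemma E_compose:
  assumes f: "f \<in> E m" and x: "x \<in> E n" and sub: "f ` U m \<subseteq> U n"
  shows "compose (U m) x f \<in> E m"
proof -
  have "xs \<in> interp (A m) R \<longleftrightarrow> map (compose (U m) x f) xs \<in> interp K R"
    if R: "R \<in> symbols L" and xs: "xs \<in> tuples L R (U m)" for R xs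
  proof -
    have fxs: "map f xs \<in> tuples L R (U n)" using xs sub by (auto simp: tuples_def)
    have "map (compose (U m) x f) xs = map x (map f xs)"
      using xs by (auto simp: tuples_def compose_def)
    moreover have "xs \<in> interp (A m) R \<longleftrightarrow> map f xs \<in> interp K R"
      using f R xs by (auto simp: H_def Emb_def)
    moreover have "map f xs \<in> interp K R \<longleftrightarrow> map f xs \<in> interp (A n) R"
      using substructure_K[of n] R fxs by (auto simp: substructure_def)
    moreover have "map f xs \<in> interp (A n) R \<longleftrightarrow> map x (map f xs) \<in> interp K R"
      using x R fxs unfolding H_def Emb_def by blast
    ultimately show ?thesis by metis
  qed
  moreover have "inj_on (compose (U m) x f) (U m)"
  proof (rule inj_onI)
    fix a b assume ab: "a \<in> U m" "b \<in> U m" "compose (U m) x f a = compose (U m) x f b"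
    then have "x (f a) = x (f b)" by (simp add: compose_def)
    moreover have "f a \<in> U n" "f b \<in> U n" using ab sub by auto
    moreover have "inj_on x (U n)" "inj_on f (U m)" using x f by (auto simp: H_def Emb_def)
    ultimately show "a = b" using ab by (meson inj_onD)
  qed
  moreover have "compose (U m) x f \<in> U m \<rightarrow>\<^sub>E universe K"
    using x sub by (auto simp: H_def Emb_def compose_def)
  ultimately show ?thesis by (simp add: H_def Emb_def)
qed

lemma finite_subset_U:
  assumes "finite X" "X \<subseteq> universe K"
  obtains n where "m \<le> n" "X \<subseteq> U n"
proof -
  have "\<exists>n\<ge>m. X \<subseteq> U n" using assms
  proof (induction X rule: finite_induct)
    case (insert a X)
    then obtain n where n: "n \<ge> m" "X \<subseteq> U n" by auto
    obtain k where k: "a \<in> U k" using insert.prems universe_K by auto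
    have "insert a X \<subseteq> U (max n k)" using n k U_mono[of n "max n k"] U_mono[of k "max n k"] by auto
    then show ?case using n(1) by (intro exI[of _ "max n k"]) auto
  qed auto
  then show thesis using that by blast
qed

lemma finite_E_level:
  assumes "finite F" "F \<subseteq> E m"
  obtains n where "m \<le> n" "\<And>f. f \<in> F \<Longrightarrow> f ` U m \<subseteq> U n"
proof -
  have "finite (\<Union>f\<in>F. f ` U m)" using assms(1) finite_U by auto
  moreover have "(\<Union>f\<in>F. f ` U m) \<subseteq> universe K" using assms(2) E_image by blast
  ultimately obtain n where "m \<le> n" "(\<Union>f\<in>F. f ` U m) \<subseteq> U n" by (rule finite_subset_U)
  then show thesis using that by blast
qed

lemma E_level:
  assumes "f \<in> E m"
  obtains n where "m \<le> n" "f ` U m \<subseteq> U n"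
  using finite_E_level[of "{f}" m] assms by auto

text \<open>Ultrahomogeneity, applied to the isomorphism from \<open>A n\<close> onto the substructure
  induced on the image of \<open>x\<close>.\<close>

lemma E_extends_to_Aut:
  assumes x: "x \<in> E n"
  obtains g where "g \<in> Aut L K" "restrict g (U n) = x"
proof -
  define C where "C = \<lparr>universe = x ` U n, interp = \<lambda>R. interp K R \<inter> tuples L R (x ` U n)\<rparr>"
  have emb: "x \<in> Emb L (A n) K" using x by (simp add: H_def)
  have C: "substructure L C K" "finite (universe C)"
    using E_image[OF x] finite_U by (auto simp: C_def substructure_def)
  have "map x xs \<in> tuples L R (x ` U n)" if "xs \<in> tuples L R (U n)" for xs R
    using that by (auto simp: tuples_def)
  then have "x \<in> Iso L (A n) C"
    using emb by (auto simp: Iso_def Emb_def C_def)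
  then obtain g where g: "g \<in> Aut L K" "\<forall>a\<in>U n. g a = x a"
    using fraisse substructure_K finite_U C
    unfolding fraisse_structure_def ultrahomogeneous_def by blast
  have "x \<in> extensional (U n)" using emb by (auto simp: Emb_def PiE_def)
  then have "restrict g (U n) = x" using g(2) by (auto simp: extensional_def restrict_def)
  then show thesis using that g(1) by blast
qed

lemma Aut_restrict: "g \<in> Aut L K \<Longrightarrow> restrict g (U n) \<in> E n"
  using Emb_restrict[OF _ substructure_K, of g K n] by (simp add: Aut_def Iso_def H_def)

lemma compose_restrict:
  "f ` U m \<subseteq> U n \<Longrightarrow> compose (U m) (restrict g (U n)) f = compose (U m) g f"
  by (auto simp: compose_def restrict_def fun_eq_iff)

lemma Aut_compose:
  assumes "g \<in> Aut L K" "f \<in> E m"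
  shows "compose (U m) g f \<in> E m"
proof -
  obtain n where "f ` U m \<subseteq> U n" using E_level[OF assms(2)] .
  then show ?thesis
    using E_compose[OF assms(2) Aut_restrict[OF assms(1)]] compose_restrict by metis
qed


section \<open>The semigroup of coherent families of ultrafilters\<close>

abbreviation S :: "(nat \<Rightarrow> ('a \<Rightarrow> 'a) set set) set" where
  "S \<equiv> SG L K A"

abbreviation dotK :: "(nat \<Rightarrow> ('a \<Rightarrow> 'a) set set) \<Rightarrow> nat \<Rightarrow> ('a \<Rightarrow> 'a) \<Rightarrow> ('a \<Rightarrow> 'a) set set" where
  "dotK \<equiv> dot L K A"

abbreviation mult ::
  "(nat \<Rightarrow> ('a \<Rightarrow> 'a) set set) \<Rightarrow> (nat \<Rightarrow> ('a \<Rightarrow> 'a) set set) \<Rightarrow> (nat \<Rightarrow> ('a \<Rightarrow> 'a) set set)"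
  (infixl "\<odot>" 70) where
  "\<alpha> \<odot> \<gamma> \<equiv> SG_mult L K A \<alpha> \<gamma>"

lemma SG_beta: "\<alpha> \<in> S \<Longrightarrow> \<alpha> n \<in> beta (E n)"
  by (simp add: SG_def)

lemma restr_eq:
  assumes "m \<le> n" "p \<in> beta (E n)"
  shows "restr L K A n m p = {Q. Q \<subseteq> E m \<and> {x \<in> E n. restrict x (U m) \<in> Q} \<in> p}"
  unfolding restr_def by (rule stone_extension_eq) (use E_restrict assms in auto)

lemma SG_restr:
  assumes "\<alpha> \<in> S" "m \<le> n" "Q \<subseteq> E m"
  shows "{x \<in> E n. restrict x (U m) \<in> Q} \<in> \<alpha> n \<longleftrightarrow> Q \<in> \<alpha> m"
proof -
  have "\<alpha> m = restr L K A n m (\<alpha> n)" using assms by (simp add: SG_def)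
  then show ?thesis using restr_eq[OF assms(2) SG_beta[OF assms(1)]] assms(3) by simp
qed

lemma SG_I:
  assumes "\<And>n. \<alpha> n \<in> beta (E n)"
    and "\<And>m n Q. m \<le> n \<Longrightarrow> Q \<subseteq> E m \<Longrightarrow> {x \<in> E n. restrict x (U m) \<in> Q} \<in> \<alpha> n \<longleftrightarrow> Q \<in> \<alpha> m"
  shows "\<alpha> \<in> S"
proof -
  have "restr L K A n m (\<alpha> n) = \<alpha> m" if "m \<le> n" for m n
    unfolding restr_eq[OF that assms(1)]
    using assms(2)[OF that] in_betaD(1)[OF assms(1)[of m]] by auto
  then show ?thesis using assms(1) by (simp add: SG_def)
qed

lemma dot_iff:
  assumes "\<alpha> \<in> S" "f \<in> E m" "m \<le> n" "f ` U m \<subseteq> U n"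
  shows "Q \<in> dotK \<alpha> m f \<longleftrightarrow> Q \<subseteq> E m \<and> {x \<in> E n. compose (U m) x f \<in> Q} \<in> \<alpha> n"
  using dot_eq_dot_at[OF exh assms] by (simp add: dot_at_def)

lemma dot_in_beta:
  assumes "\<alpha> \<in> S" "f \<in> E m"
  shows "dotK \<alpha> m f \<in> beta (E m)"
proof -
  obtain n where n: "m \<le> n" "f ` U m \<subseteq> U n" using E_level[OF assms(2)] .
  have "dotK \<alpha> m f = {Q. Q \<subseteq> E m \<and> {x \<in> E n. compose (U m) x f \<in> Q} \<in> \<alpha> n}"
    using dot_iff[OF assms n] by blast
  then show ?thesis
    using image_ultrafilter_in_beta[of "\<lambda>x. compose (U m) x f" "E n" "E m" "\<alpha> n"]
      E_compose[OF assms(2) _ n(2)] SG_beta[OF assms(1)] by auto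
qed

lemma mult_iff:
  "Q \<in> (\<alpha> \<odot> \<gamma>) m \<longleftrightarrow> Q \<subseteq> E m \<and> {f \<in> E m. Q \<in> dotK \<alpha> m f} \<in> \<gamma> m"
  by (simp add: SG_mult_def)

text \<open>Both sides concern the maps \<open>z \<circ> f\<close> restricted to \<open>A m\<close>, for \<open>\<alpha>\<close>-almost all \<open>z\<close>. This makes the
  coordinates of a product coherent.\<close>

lemma dot_restrict:
  assumes \<alpha>: "\<alpha> \<in> S" and f: "f \<in> E n" and mn: "m \<le> n" and Q: "Q \<subseteq> E m"
  shows "{x \<in> E n. restrict x (U m) \<in> Q} \<in> dotK \<alpha> n f \<longleftrightarrow> Q \<in> dotK \<alpha> m (restrict f (U m))"
proof -
  obtain k where k: "n \<le> k" "f ` U n \<subseteq> U k" using E_level[OF f] .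
  have rk: "restrict f (U m) ` U m \<subseteq> U k" using k(2) U_mono[OF mn] by auto
  have "restrict (compose (U n) z f) (U m) = compose (U m) z (restrict f (U m))" for z :: "'a \<Rightarrow> 'a"
    using U_mono[OF mn] by (auto simp: compose_def restrict_def fun_eq_iff)
  then have "{z \<in> E k. compose (U n) z f \<in> {x \<in> E n. restrict x (U m) \<in> Q}}
      = {z \<in> E k. compose (U m) z (restrict f (U m)) \<in> Q}"
    using E_compose[OF f _ k(2)] by auto
  then show ?thesis
    using dot_iff[OF \<alpha> f k] dot_iff[OF \<alpha> E_restrict[OF mn f] _ rk] Q mn k(1) by auto
qed

text \<open>Coordinate \<open>m\<close> of \<open>\<alpha> \<gamma>\<close> is the limit of the ultrafilters \<open>\<alpha> \<cdot> f\<close> along \<open>\<gamma>(m)\<close>.\<close>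

lemma mult_in_SG:
  assumes \<alpha>: "\<alpha> \<in> S" and \<gamma>: "\<gamma> \<in> S"
  shows "\<alpha> \<odot> \<gamma> \<in> S"
proof (rule SG_I)
  fix n
  show "(\<alpha> \<odot> \<gamma>) n \<in> beta (E n)"
    unfolding SG_mult_def
    using ultrafilter_limit_in_beta[of "E n" "dotK \<alpha> n", OF dot_in_beta[OF \<alpha>] SG_beta[OF \<gamma>]] by simp
next
  fix m n Q assume mn: "m \<le> n" and Q: "Q \<subseteq> E m"
  have "{f \<in> E n. {x \<in> E n. restrict x (U m) \<in> Q} \<in> dotK \<alpha> n f}
      = {f \<in> E n. restrict f (U m) \<in> {h \<in> E m. Q \<in> dotK \<alpha> m h}}"
    using dot_restrict[OF \<alpha> _ mn Q] E_restrict[OF mn] by auto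
  then show "{x \<in> E n. restrict x (U m) \<in> Q} \<in> (\<alpha> \<odot> \<gamma>) n \<longleftrightarrow> Q \<in> (\<alpha> \<odot> \<gamma>) m"
    using SG_restr[OF \<gamma> mn, of "{h \<in> E m. Q \<in> dotK \<alpha> m h}"] Q by (auto simp: mult_iff)
qed

text \<open>Both sides say that \<open>Q \<in> \<alpha> \<cdot> (y \<circ> f)\<close> for \<open>\<gamma>\<close>-almost all \<open>y\<close>. This is associativity of the
  product with a point \<open>f\<close> of \<open>H\<^sub>m\<close> in place of the third factor.\<close>

lemma dot_mult:
  assumes \<alpha>: "\<alpha> \<in> S" and \<gamma>: "\<gamma> \<in> S" and f: "f \<in> E m"
  shows "Q \<in> dotK (\<alpha> \<odot> \<gamma>) m f \<longleftrightarrow> Q \<subseteq> E m \<and> {h \<in> E m. Q \<in> dotK \<alpha> m h} \<in> dotK \<gamma> m f"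
proof (cases "Q \<subseteq> E m")
  case Q: True
  obtain n where n: "m \<le> n" "f ` U m \<subseteq> U n" using E_level[OF f] .
  have "{x \<in> E n. compose (U m) x f \<in> Q} \<in> dotK \<alpha> n y \<longleftrightarrow> Q \<in> dotK \<alpha> m (compose (U m) y f)"
    if y: "y \<in> E n" for y
  proof -
    obtain k where k: "n \<le> k" "y ` U n \<subseteq> U k" using E_level[OF y] .
    have yf: "compose (U m) y f \<in> E m" by (rule E_compose[OF f y n(2)])
    have yfk: "compose (U m) y f ` U m \<subseteq> U k" using n(2) k(2) by (auto simp: compose_def)
    have "compose (U m) (compose (U n) z y) f = compose (U m) z (compose (U m) y f)" for z :: "'a \<Rightarrow> 'a"
      using n(2) by (auto simp: compose_def restrict_def fun_eq_iff)
    then have "{z \<in> E k. compose (U n) z y \<in> {x \<in> E n. compose (U m) x f \<in> Q}}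
        = {z \<in> E k. compose (U m) z (compose (U m) y f) \<in> Q}"
      using E_compose[OF y _ k(2)] by auto
    then show ?thesis
      using dot_iff[OF \<alpha> y k] dot_iff[OF \<alpha> yf _ yfk] Q n(1) k(1) by auto
  qed
  then have "{y \<in> E n. {x \<in> E n. compose (U m) x f \<in> Q} \<in> dotK \<alpha> n y}
      = {y \<in> E n. compose (U m) y f \<in> {h \<in> E m. Q \<in> dotK \<alpha> m h}}"
    using E_compose[OF f _ n(2)] by auto
  then show ?thesis
    using dot_iff[OF mult_in_SG[OF \<alpha> \<gamma>] f n] dot_iff[OF \<gamma> f n] Q by (auto simp: mult_iff)
qed (use in_betaD(1)[OF dot_in_beta[OF mult_in_SG[OF \<alpha> \<gamma>] f]] in auto)

lemma mult_assoc:
  assumes "\<alpha> \<in> S" "\<gamma> \<in> S"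
  shows "\<alpha> \<odot> \<gamma> \<odot> \<delta> = \<alpha> \<odot> (\<gamma> \<odot> \<delta>)"
proof (intro ext set_eqI)
  fix m Q
  show "Q \<in> (\<alpha> \<odot> \<gamma> \<odot> \<delta>) m \<longleftrightarrow> Q \<in> (\<alpha> \<odot> (\<gamma> \<odot> \<delta>)) m"
  proof (cases "Q \<subseteq> E m")
    case True
    then have "{f \<in> E m. Q \<in> dotK (\<alpha> \<odot> \<gamma>) m f}
        = {f \<in> E m. {h \<in> E m. Q \<in> dotK \<alpha> m h} \<in> dotK \<gamma> m f}"
      using dot_mult[OF assms] by auto
    then show ?thesis
      unfolding mult_iff[of Q "\<alpha> \<odot> \<gamma>"] mult_iff[of Q \<alpha>] mult_iff[of _ \<gamma> \<delta>] by auto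
  qed (simp add: mult_iff)
qed

text \<open>This is the canonical map from \<open>Aut(K)\<close> to \<open>S(G)\<close>.\<close>

definition aut_point :: "('a \<Rightarrow> 'a) \<Rightarrow> nat \<Rightarrow> ('a \<Rightarrow> 'a) set set" where
  "aut_point g = (\<lambda>n. principal (E n) (restrict g (U n)))"

lemma aut_point_in_SG:
  assumes "g \<in> Aut L K"
  shows "aut_point g \<in> S"
proof (rule SG_I)
  show "aut_point g n \<in> beta (E n)" for n
    using principal_in_beta[OF Aut_restrict[OF assms]] by (simp add: aut_point_def)
next
  fix m n Q assume "m \<le> n" "Q \<subseteq> E m"
  moreover have "restrict (restrict g (U n)) (U m) = restrict g (U m)"
    using U_mono[OF \<open>m \<le> n\<close>] by (auto simp: restrict_def fun_eq_iff)
  ultimately show "{x \<in> E n. restrict x (U m) \<in> Q} \<in> aut_point g n \<longleftrightarrow> Q \<in> aut_point g m"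
    using Aut_restrict[OF assms] by (auto simp: aut_point_def principal_def)
qed

lemma dot_aut_point:
  assumes g: "g \<in> Aut L K" and f: "f \<in> E m" and Q: "Q \<subseteq> E m"
  shows "Q \<in> dotK (aut_point g) m f \<longleftrightarrow> compose (U m) g f \<in> Q"
proof -
  obtain n where n: "m \<le> n" "f ` U m \<subseteq> U n" using E_level[OF f] .
  have "{x \<in> E n. compose (U m) x f \<in> Q} \<in> aut_point g n
      \<longleftrightarrow> compose (U m) (restrict g (U n)) f \<in> Q"
    using Aut_restrict[OF g, of n] unfolding aut_point_def principal_def by blast
  then show ?thesis
    using dot_iff[OF aut_point_in_SG[OF g] f n] Q unfolding compose_restrict[OF n(2)] by blast
qed

text \<open>The points of \<open>Aut(K)\<close> already realise every principal ultrafilter in coordinate \<open>m\<close>, so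
  they force \<open>{f. T \<in> \<alpha> \<cdot> f}\<close> to contain every \<open>f\<close>.\<close>

lemma all_translates_iff:
  assumes "\<alpha> \<in> S" "T \<subseteq> E m"
  shows "(\<forall>\<gamma>\<in>S. T \<in> (\<alpha> \<odot> \<gamma>) m) \<longleftrightarrow> (\<forall>f\<in>E m. T \<in> dotK \<alpha> m f)"
proof (intro iffI ballI)
  fix f assume \<gamma>: "\<forall>\<gamma>\<in>S. T \<in> (\<alpha> \<odot> \<gamma>) m" and f: "f \<in> E m"
  obtain g where g: "g \<in> Aut L K" "restrict g (U m) = f" using E_extends_to_Aut[OF f] .
  have "T \<in> (\<alpha> \<odot> aut_point g) m" using \<gamma> aut_point_in_SG[OF g(1)] by blast
  then show "T \<in> dotK \<alpha> m f"
    using g(2) by (auto simp: mult_iff aut_point_def principal_def)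
next
  fix \<gamma> assume "\<forall>f\<in>E m. T \<in> dotK \<alpha> m f" "\<gamma> \<in> S"
  then have "{f \<in> E m. T \<in> dotK \<alpha> m f} = E m" by auto
  then show "T \<in> (\<alpha> \<odot> \<gamma>) m"
    using assms(2) in_betaD(2)[OF SG_beta[OF \<open>\<gamma> \<in> S\<close>]] by (simp add: mult_iff)
qed


section \<open>Compactness and minimal right ideals\<close>

definition ultralimit ::
  "(nat \<Rightarrow> ('a \<Rightarrow> 'a) set set) set set \<Rightarrow> nat \<Rightarrow> ('a \<Rightarrow> 'a) set set" where
  "ultralimit W = (\<lambda>n. {Q. Q \<subseteq> E n \<and> {\<gamma> \<in> S. Q \<in> \<gamma> n} \<in> W})"

lemma ultralimit_in_SG:
  assumes "W \<in> beta S"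
  shows "ultralimit W \<in> S"
proof (rule SG_I)
  show "ultralimit W n \<in> beta (E n)" for n
    unfolding ultralimit_def
    by (rule ultrafilter_limit_in_beta[where p = "\<lambda>\<gamma>. \<gamma> n"]) (auto intro: SG_beta assms)
next
  fix m n Q assume "m \<le> n" "Q \<subseteq> E m"
  moreover have "{\<gamma> \<in> S. {x \<in> E n. restrict x (U m) \<in> Q} \<in> \<gamma> n} = {\<gamma> \<in> S. Q \<in> \<gamma> m}"
    using SG_restr[OF _ \<open>m \<le> n\<close> \<open>Q \<subseteq> E m\<close>] by auto
  ultimately show "{x \<in> E n. restrict x (U m) \<in> Q} \<in> ultralimit W n \<longleftrightarrow> Q \<in> ultralimit W m"
    by (auto simp: ultralimit_def)
qed

text \<open>Closedness in the inverse limit topology: the sets \<open>{\<gamma> \<in> S. Q \<in> \<gamma> n}\<close> form a base of it, because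
  finitely many conditions in various coordinates combine into one in a late coordinate.\<close>

definition closed_SG :: "(nat \<Rightarrow> ('a \<Rightarrow> 'a) set set) set \<Rightarrow> bool" where
  "closed_SG C \<longleftrightarrow> C \<subseteq> S \<and> (\<forall>\<delta>\<in>S. (\<forall>n. \<forall>Q\<in>\<delta> n. \<exists>\<gamma>\<in>C. Q \<in> \<gamma> n) \<longrightarrow> \<delta> \<in> C)"

text \<open>This is the form in which compactness is used: a filter base of closed sets extends to an
  ultrafilter, whose limit is a common point of them.\<close>

lemma ultralimit_in_closed:
  assumes W: "W \<in> beta S" and C: "closed_SG C" "C \<in> W"
  shows "ultralimit W \<in> C"
proof -
  have "\<exists>\<gamma>\<in>C. Q \<in> \<gamma> n" if "Q \<in> ultralimit W n" for n Q
  proof -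
    have "{\<gamma> \<in> S. Q \<in> \<gamma> n} \<inter> C \<in> W"
      using that C(2) in_betaD(4)[OF W] by (auto simp: ultralimit_def)
    then have "{\<gamma> \<in> S. Q \<in> \<gamma> n} \<inter> C \<noteq> {}" using in_betaD(3)[OF W] by metis
    then show ?thesis by blast
  qed
  then show ?thesis using C(1) ultralimit_in_SG[OF W] by (simp add: closed_SG_def)
qed

text \<open>Left multiplication by \<open>\<alpha>\<close> commutes with ultralimits. A point \<open>\<delta>\<close> in the closure of \<open>\<alpha> S(G)\<close> is
  therefore \<open>\<alpha> \<gamma>\<close> for the limit \<open>\<gamma>\<close> of any ultrafilter on \<open>S(G)\<close> that contains, for each
  \<open>Q \<in> \<delta>(n)\<close>, the set of all \<open>\<gamma>'\<close> with \<open>Q \<in> (\<alpha> \<gamma>')(n)\<close>.\<close>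

lemma closed_principal_right_ideal:
  assumes \<alpha>: "\<alpha> \<in> S"
  shows "closed_SG ((\<odot>) \<alpha> ` S)"
  unfolding closed_SG_def
proof (intro conjI ballI impI)
  show "(\<odot>) \<alpha> ` S \<subseteq> S" using mult_in_SG[OF \<alpha>] by auto
next
  fix \<delta> assume \<delta>: "\<delta> \<in> S" and adh: "\<forall>n. \<forall>Q\<in>\<delta> n. \<exists>\<gamma>\<in>(\<odot>) \<alpha> ` S. Q \<in> \<gamma> n"
  define B where "B n Q = {\<gamma> \<in> S. Q \<in> (\<alpha> \<odot> \<gamma>) n}" for n Q
  define \<F> where "\<F> = {B n Q | n Q. Q \<in> \<delta> n}"
  have "\<exists>D\<in>\<F>. D \<subseteq> X \<inter> Y" if XY: "X \<in> \<F>" "Y \<in> \<F>" for X Y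
  proof -
    obtain n Q n' Q' where X: "X = B n Q" "Q \<in> \<delta> n" and Y: "Y = B n' Q'" "Q' \<in> \<delta> n'"
      using XY unfolding \<F>_def by blast
    \<comment> \<open>pull both conditions back to a common coordinate and intersect them there\<close>
    define k where "k = max n n'"
    have k: "n \<le> k" "n' \<le> k" by (auto simp: k_def)
    define P where "P = {x \<in> E k. restrict x (U n) \<in> Q}"
    define P' where "P' = {x \<in> E k. restrict x (U n') \<in> Q'}"
    have Q: "Q \<subseteq> E n" "Q' \<subseteq> E n'" using X Y in_betaD(1)[OF SG_beta[OF \<delta>]] by auto
    have "P \<in> \<delta> k" "P' \<in> \<delta> k"
      using SG_restr[OF \<delta> k(1) Q(1)] SG_restr[OF \<delta> k(2) Q(2)] X Y by (auto simp: P_def P'_def)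
    then have PP: "P \<inter> P' \<in> \<delta> k" using in_betaD(4)[OF SG_beta[OF \<delta>]] by blast
    have "B k (P \<inter> P') \<subseteq> X \<inter> Y"
    proof
      fix \<gamma> assume \<gamma>: "\<gamma> \<in> B k (P \<inter> P')"
      then have "\<alpha> \<odot> \<gamma> \<in> S" "\<gamma> \<in> S" "P \<inter> P' \<in> (\<alpha> \<odot> \<gamma>) k"
        using mult_in_SG[OF \<alpha>] by (auto simp: B_def)
      moreover from this have "P \<in> (\<alpha> \<odot> \<gamma>) k" "P' \<in> (\<alpha> \<odot> \<gamma>) k"
        by (auto intro: in_betaD(5)[OF SG_beta] simp: P_def P'_def)
      ultimately show "\<gamma> \<in> X \<inter> Y"
        using SG_restr[OF _ k(1) Q(1)] SG_restr[OF _ k(2) Q(2)] by (auto simp: B_def X Y P_def P'_def)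
    qed
    then show ?thesis using PP by (auto simp: \<F>_def)
  qed
  moreover have "\<F> \<subseteq> Pow S" by (auto simp: \<F>_def B_def)
  moreover have "\<F> \<noteq> {}" using in_betaD(2)[OF SG_beta[OF \<delta>]] by (auto simp: \<F>_def)
  moreover have "{} \<notin> \<F>" using adh by (force simp: \<F>_def B_def)
  ultimately obtain W where "ultrafilter_on S W" and \<F>: "\<F> \<subseteq> W"
    using filter_base_extends_to_ultrafilter[of \<F> S] by metis
  then have W: "W \<in> beta S" by (simp add: beta_def)
  have lim: "ultralimit W \<in> S" by (rule ultralimit_in_SG[OF W])
  have "\<delta> n = (\<alpha> \<odot> ultralimit W) n" for n
  proof (rule ultrafilter_subset_eq[OF SG_beta[OF \<delta>] SG_beta[OF mult_in_SG[OF \<alpha> lim]]], rule subsetI)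
    fix Q assume Q: "Q \<in> \<delta> n"
    then have "B n Q \<in> W" using \<F> by (auto simp: \<F>_def)
    moreover have "Q \<subseteq> E n" using in_betaD(1)[OF SG_beta[OF \<delta>] Q] .
    ultimately show "Q \<in> (\<alpha> \<odot> ultralimit W) n"
      by (simp add: mult_iff ultralimit_def B_def)
  qed
  then have "\<delta> = \<alpha> \<odot> ultralimit W" by (rule ext)
  then show "\<delta> \<in> (\<odot>) \<alpha> ` S" using lim by (rule image_eqI)
qed

lemma right_ideal_principal:
  assumes \<alpha>: "\<alpha> \<in> S"
  shows "right_ideal L K A ((\<odot>) \<alpha> ` S)"
  unfolding right_ideal_def
proof (intro conjI ballI)
  show "(\<odot>) \<alpha> ` S \<noteq> {}" using \<alpha> by auto
  show "(\<odot>) \<alpha> ` S \<subseteq> S" using mult_in_SG[OF \<alpha>] by blast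
next
  fix \<beta> \<delta> assume "\<beta> \<in> (\<odot>) \<alpha> ` S" "\<delta> \<in> S"
  then obtain \<gamma> where "\<gamma> \<in> S" "\<beta> = \<alpha> \<odot> \<gamma>" by blast
  then have "\<beta> \<odot> \<delta> = \<alpha> \<odot> (\<gamma> \<odot> \<delta>)" "\<gamma> \<odot> \<delta> \<in> S"
    using mult_assoc[OF \<alpha>] mult_in_SG \<open>\<delta> \<in> S\<close> by simp_all
  then show "\<beta> \<odot> \<delta> \<in> (\<odot>) \<alpha> ` S" by blast
qed

text \<open>By Zorn's lemma and compactness there is a minimal \<^emph>\<open>closed\<close> right ideal. It is minimal among
  all right ideals, because any right ideal contains a closed one, namely \<open>\<alpha> S(G)\<close> for any
  of its points \<open>\<alpha>\<close>.\<close>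

lemma closed_right_ideal_contains_minimal:
  assumes R: "right_ideal L K A R" "closed_SG R"
  obtains I where "minimal_right_ideal L K A I" "I \<subseteq> R"
proof -
  define Z where "Z = {J. right_ideal L K A J \<and> closed_SG J \<and> J \<subseteq> R}"
  have RZ: "R \<in> Z" using R by (simp add: Z_def)
  have "\<exists>I\<in>Z. \<forall>J\<in>Z. J \<subseteq> I \<longrightarrow> J = I"
  proof (rule predicate_Zorn[where P = "\<lambda>J J'. J' \<subseteq> J"])
    show "partial_order_on Z (relation_of (\<lambda>J J'. J' \<subseteq> J) Z)"
      by (rule partial_order_on_relation_ofI) auto
  next
    fix \<C> assume "\<C> \<in> Chains (relation_of (\<lambda>J J'. J' \<subseteq> J) Z)"
    then have \<C>: "\<C> \<subseteq> Z" "\<And>J J'. J \<in> \<C> \<Longrightarrow> J' \<in> \<C> \<Longrightarrow> J \<subseteq> J' \<or> J' \<subseteq> J"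
      by (auto simp: Chains_def relation_of_def)
    show "\<exists>J\<in>Z. \<forall>J'\<in>\<C>. J \<subseteq> J'"
    proof (cases "\<C> = {}")
      case True
      then show ?thesis using RZ by auto
    next
      case False
      have "\<exists>D\<in>\<C>. D \<subseteq> X \<inter> Y" if "X \<in> \<C>" "Y \<in> \<C>" for X Y using \<C>(2)[OF that] that by blast
      moreover have "\<C> \<subseteq> Pow S" "{} \<notin> \<C>" using \<C>(1) by (auto simp: Z_def right_ideal_def)
      ultimately obtain W where "ultrafilter_on S W" and sub: "\<C> \<subseteq> W"
        using filter_base_extends_to_ultrafilter[of \<C> S] False by metis
      then have W: "W \<in> beta S" by (simp add: beta_def)
      have "ultralimit W \<in> \<Inter>\<C>"
        using ultralimit_in_closed[OF W] \<C>(1) sub by (auto simp: Z_def)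
      moreover obtain J0 where "J0 \<in> \<C>" using False by blast
      moreover have sub_S: "J \<subseteq> S" and "\<alpha> \<in> J \<Longrightarrow> \<gamma> \<in> S \<Longrightarrow> \<alpha> \<odot> \<gamma> \<in> J" if "J \<in> \<C>" for J \<alpha> \<gamma>
        using that \<C>(1) by (auto simp: Z_def right_ideal_def)
      ultimately have "right_ideal L K A (\<Inter>\<C>)"
        unfolding right_ideal_def by (intro conjI ballI InterI) (blast, blast, blast)
      moreover have "closed_SG (\<Inter>\<C>)"
        unfolding closed_SG_def
      proof (intro conjI ballI impI InterI)
        show "\<Inter>\<C> \<subseteq> S" using \<open>J0 \<in> \<C>\<close> sub_S by blast
      next
        fix \<delta> J assume "\<delta> \<in> S" "\<forall>n. \<forall>Q\<in>\<delta> n. \<exists>\<gamma>\<in>\<Inter>\<C>. Q \<in> \<gamma> n" and J: "J \<in> \<C>"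
        then have "\<forall>n. \<forall>Q\<in>\<delta> n. \<exists>\<gamma>\<in>J. Q \<in> \<gamma> n" by (meson InterD)
        moreover have "closed_SG J" using J \<C>(1) by (auto simp: Z_def)
        ultimately show "\<delta> \<in> J" using \<open>\<delta> \<in> S\<close> unfolding closed_SG_def by blast
      qed
      moreover have "\<Inter>\<C> \<subseteq> R" using \<C>(1) False by (auto simp: Z_def)
      ultimately have "\<Inter>\<C> \<in> Z" by (simp add: Z_def)
      then show ?thesis by blast
    qed
  qed
  then obtain I where I: "I \<in> Z" and min: "\<And>J. J \<in> Z \<Longrightarrow> J \<subseteq> I \<Longrightarrow> J = I" by blast
  have "J = I" if J: "right_ideal L K A J" "J \<subseteq> I" for J
  proof -
    obtain \<alpha> where \<alpha>: "\<alpha> \<in> J" "\<alpha> \<in> S" using J(1) by (auto simp: right_ideal_def)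
    have sub: "(\<odot>) \<alpha> ` S \<subseteq> J" using J(1) \<alpha>(1) by (auto simp: right_ideal_def)
    then have "(\<odot>) \<alpha> ` S \<in> Z"
      using right_ideal_principal[OF \<alpha>(2)] closed_principal_right_ideal[OF \<alpha>(2)] J(2) I
      by (auto simp: Z_def)
    then have "(\<odot>) \<alpha> ` S = I" using min sub J(2) by blast
    then show ?thesis using sub J(2) by blast
  qed
  then have "minimal_right_ideal L K A I" using I by (simp add: minimal_right_ideal_def Z_def)
  then show thesis using that I by (simp add: Z_def)
qed


section \<open>Thick sets\<close>

text \<open>A neighbourhood of the constant function \<open>True\<close> restricts only finitely many coordinates.\<close>

lemma thick_iff_finite:
  "thick L K A m T \<longleftrightarrow> (\<forall>F. finite F \<and> F \<subseteq> E m \<longrightarrow> (\<exists>g\<in>Aut L K. \<forall>f\<in>F. compose (U m) g f \<in> T))"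
proof
  assume thick: "thick L K A m T"
  show "\<forall>F. finite F \<and> F \<subseteq> E m \<longrightarrow> (\<exists>g\<in>Aut L K. \<forall>f\<in>F. compose (U m) g f \<in> T)"
  proof (intro allI impI, elim conjE)
    fix F assume F: "finite F" "F \<subseteq> E m"
    define N where "N = (\<Pi>\<^sub>E f\<in>E m. if f \<in> F then {True} else UNIV)"
    have "openin (cantor_space (E m)) N"
      unfolding cantor_space_def N_def openin_PiE_gen
      by (rule disjI2) (use F in \<open>auto intro: finite_subset[OF _ F(1)] split: if_splits\<close>)
    moreover have "chi (E m) (E m) \<in> N" by (auto simp: N_def chi_def)
    ultimately obtain g where g: "g \<in> Aut L K" "act L K A m (chi (E m) T) g \<in> N"
      using thick unfolding thick_def in_closure_of by blast
    have "compose (U m) g f \<in> T" if "f \<in> F" for f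
    proof -
      have f: "f \<in> E m" using that F(2) by blast
      then have "act L K A m (chi (E m) T) g f" using g(2) that by (force simp: N_def PiE_def Pi_def)
      then show ?thesis using f Aut_compose[OF g(1) f] by (simp add: act_def chi_def)
    qed
    then show "\<exists>g\<in>Aut L K. \<forall>f\<in>F. compose (U m) g f \<in> T" using g(1) by blast
  qed
next
  assume fin: "\<forall>F. finite F \<and> F \<subseteq> E m \<longrightarrow> (\<exists>g\<in>Aut L K. \<forall>f\<in>F. compose (U m) g f \<in> T)"
  show "thick L K A m T"
    unfolding thick_def in_closure_of
  proof (intro conjI allI impI)
    show "chi (E m) (E m) \<in> topspace (cantor_space (E m))"
      by (auto simp: cantor_space_def chi_def)
  next
    fix N assume "chi (E m) (E m) \<in> N \<and> openin (cantor_space (E m)) N"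
    then obtain V where V: "finite {f \<in> E m. V f \<noteq> UNIV}" "chi (E m) (E m) \<in> Pi\<^sub>E (E m) V"
        "Pi\<^sub>E (E m) V \<subseteq> N"
      unfolding cantor_space_def openin_product_topology_alt by force
    then obtain g where g: "g \<in> Aut L K" "\<And>f. f \<in> E m \<Longrightarrow> V f \<noteq> UNIV \<Longrightarrow> compose (U m) g f \<in> T"
      using fin[rule_format, of "{f \<in> E m. V f \<noteq> UNIV}"] by auto
    have "act L K A m (chi (E m) T) g f \<in> V f" if f: "f \<in> E m" for f
    proof (cases "V f = UNIV")
      case False
      have "True \<in> V f" using V(2) f by (force simp: chi_def PiE_def Pi_def)
      then show ?thesis using g(2)[OF f False] f Aut_compose[OF g(1) f] by (simp add: act_def chi_def)
    qed simp
    then have "act L K A m (chi (E m) T) g \<in> N" using V(3) by (force simp: act_def)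
    then show "\<exists>y. y \<in> {act L K A m (chi (E m) T) g |g. g \<in> Aut L K} \<and> y \<in> N" using g(1) by blast
  qed
qed

text \<open>From left to right the point is a limit of automorphisms \<open>g\<^sub>F\<close> that move larger and larger
  finite sets \<open>F\<close> into \<open>T\<close>; from right to left an \<open>x\<close> that is typical for \<open>\<alpha>(n)\<close> moves \<open>F\<close> into
  \<open>T\<close>.\<close>

lemma thick_iff_point:
  assumes T: "T \<subseteq> E m"
  shows "thick L K A m T \<longleftrightarrow> (\<exists>\<alpha>\<in>S. \<forall>f\<in>E m. T \<in> dotK \<alpha> m f)"
proof
  assume thick: "thick L K A m T"
  define B where "B F = {\<gamma> \<in> S. \<forall>f\<in>F. T \<in> dotK \<gamma> m f}" for F
  define \<F> where "\<F> = {B F | F. finite F \<and> F \<subseteq> E m}"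
  have "B F \<noteq> {}" if F: "finite F" "F \<subseteq> E m" for F
  proof -
    obtain g where g: "g \<in> Aut L K" "\<forall>f\<in>F. compose (U m) g f \<in> T"
      using thick F unfolding thick_iff_finite by blast
    then have "aut_point g \<in> B F"
      using F(2) dot_aut_point[OF g(1) _ T] aut_point_in_SG by (auto simp: B_def)
    then show ?thesis by blast
  qed
  then have "{} \<notin> \<F>" unfolding \<F>_def by blast
  moreover have "\<exists>D\<in>\<F>. D \<subseteq> X \<inter> Y" if XY: "X \<in> \<F>" "Y \<in> \<F>" for X Y
  proof -
    obtain F G where FG: "X = B F" "finite F" "F \<subseteq> E m" "Y = B G" "finite G" "G \<subseteq> E m"
      using XY by (auto simp: \<F>_def)
    have "B (F \<union> G) \<in> \<F>" unfolding \<F>_def using FG by blast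
    moreover have "B (F \<union> G) \<subseteq> X \<inter> Y" using FG by (auto simp: B_def)
    ultimately show ?thesis by blast
  qed
  moreover have "\<F> \<subseteq> Pow S" "\<F> \<noteq> {}" by (auto simp: \<F>_def B_def)
  ultimately obtain W where "ultrafilter_on S W" and \<F>: "\<F> \<subseteq> W"
    using filter_base_extends_to_ultrafilter[of \<F> S] by metis
  then have W: "W \<in> beta S" by (simp add: beta_def)
  have lim: "ultralimit W \<in> S" by (rule ultralimit_in_SG[OF W])
  have "T \<in> dotK (ultralimit W) m f" if f: "f \<in> E m" for f
  proof -
    obtain n where n: "m \<le> n" "f ` U m \<subseteq> U n" using E_level[OF f] .
    have "B {f} \<in> W" using \<F> f by (auto simp: \<F>_def)
    moreover have "B {f} = {\<gamma> \<in> S. {x \<in> E n. compose (U m) x f \<in> T} \<in> \<gamma> n}"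
      using dot_iff[OF _ f n] T by (auto simp: B_def)
    ultimately have "{x \<in> E n. compose (U m) x f \<in> T} \<in> ultralimit W n"
      by (auto simp: ultralimit_def)
    then show ?thesis using dot_iff[OF lim f n] T by blast
  qed
  then show "\<exists>\<alpha>\<in>S. \<forall>f\<in>E m. T \<in> dotK \<alpha> m f" using lim by blast
next
  assume "\<exists>\<alpha>\<in>S. \<forall>f\<in>E m. T \<in> dotK \<alpha> m f"
  then obtain \<alpha> where \<alpha>: "\<alpha> \<in> S" "\<And>f. f \<in> E m \<Longrightarrow> T \<in> dotK \<alpha> m f" by blast
  show "thick L K A m T"
    unfolding thick_iff_finite
  proof (intro allI impI, elim conjE)
    fix F assume F: "finite F" "F \<subseteq> E m"
    obtain n where n: "m \<le> n" "\<And>f. f \<in> F \<Longrightarrow> f ` U m \<subseteq> U n" using finite_E_level[OF F] by blast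
    have "{x \<in> E n. \<forall>f\<in>F. compose (U m) x f \<in> T} \<in> \<alpha> n" using F n(2)
    proof (induction F rule: finite_induct)
      case empty
      then show ?case using in_betaD(2)[OF SG_beta[OF \<alpha>(1)]] by simp
    next
      case (insert f F)
      have f: "f \<in> E m" using insert.prems by blast
      have "{x \<in> E n. compose (U m) x f \<in> T} \<in> \<alpha> n"
        using dot_iff[OF \<alpha>(1) f n(1)] \<alpha>(2)[OF f] insert.prems by blast
      moreover have "{x \<in> E n. \<forall>f\<in>F. compose (U m) x f \<in> T} \<in> \<alpha> n" using insert by blast
      ultimately have "{x \<in> E n. compose (U m) x f \<in> T} \<inter> {x \<in> E n. \<forall>f\<in>F. compose (U m) x f \<in> T} \<in> \<alpha> n"
        by (rule in_betaD(4)[OF SG_beta[OF \<alpha>(1)]])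
      then show ?case by (rule back_subst[where P = "\<lambda>Q. Q \<in> \<alpha> n"]) auto
    qed
    then have "{x \<in> E n. \<forall>f\<in>F. compose (U m) x f \<in> T} \<noteq> {}" using in_betaD(3)[OF SG_beta[OF \<alpha>(1)]] by metis
    then obtain x where x: "x \<in> E n" "\<forall>f\<in>F. compose (U m) x f \<in> T" by blast
    obtain g where g: "g \<in> Aut L K" "restrict g (U n) = x" using E_extends_to_Aut[OF x(1)] .
    \<comment> \<open>\<open>x\<close> and \<open>g\<close> agree on \<open>A n\<close>, which contains the range of each \<open>f \<in> F\<close>\<close>
    have "compose (U m) x f = compose (U m) g f" if "f \<in> F" for f
      unfolding g(2)[symmetric] by (rule compose_restrict[OF n(2)[OF that]])
    then have "\<forall>f\<in>F. compose (U m) g f \<in> T" using x(2) by simp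
    then show "\<exists>g\<in>Aut L K. \<forall>f\<in>F. compose (U m) g f \<in> T" using g(1) by blast
  qed
qed

end

theorem corollary3p7:
  fixes L :: "'r rel_language"
    and K :: "('a, 'r) rel_structure"
    and A :: "nat \<Rightarrow> ('a, 'r) rel_structure"
    and m :: nat
    and T :: "('a \<Rightarrow> 'a) set"
  assumes "fraisse_structure L K"
    and "exhaustion L K A"
    and "T \<subseteq> H L K A m"
  shows "thick L K A m T \<longleftrightarrow>
    (\<exists>I. minimal_right_ideal L K A I \<and> I \<subseteq> tilde L K A m T)"
proof -
  interpret fraisse_exhaustion L K A using assms(1,2) by unfold_locales
  have "thick L K A m T \<longleftrightarrow> (\<exists>\<alpha>\<in>S. (\<odot>) \<alpha> ` S \<subseteq> tilde L K A m T)"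
    using thick_iff_point[OF assms(3)] all_translates_iff[OF _ assms(3)] mult_in_SG
    by (auto simp: tilde_def image_subset_iff)
  also have "\<dots> \<longleftrightarrow> (\<exists>I. minimal_right_ideal L K A I \<and> I \<subseteq> tilde L K A m T)"
  proof
    assume "\<exists>\<alpha>\<in>S. (\<odot>) \<alpha> ` S \<subseteq> tilde L K A m T"
    then obtain \<alpha> where \<alpha>: "\<alpha> \<in> S" "(\<odot>) \<alpha> ` S \<subseteq> tilde L K A m T" by blast
    obtain I where "minimal_right_ideal L K A I" "I \<subseteq> (\<odot>) \<alpha> ` S"
      using closed_right_ideal_contains_minimal
        [OF right_ideal_principal[OF \<alpha>(1)] closed_principal_right_ideal[OF \<alpha>(1)]] .
    then show "\<exists>I. minimal_right_ideal L K A I \<and> I \<subseteq> tilde L K A m T" using \<alpha>(2) by blast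
  next
    assume "\<exists>I. minimal_right_ideal L K A I \<and> I \<subseteq> tilde L K A m T"
    then obtain I where I: "right_ideal L K A I" "I \<subseteq> tilde L K A m T"
      by (auto simp: minimal_right_ideal_def)
    then obtain \<alpha> where "\<alpha> \<in> I" "\<alpha> \<in> S" by (auto simp: right_ideal_def)
    have "(\<odot>) \<alpha> ` S \<subseteq> I" using I(1) \<open>\<alpha> \<in> I\<close> by (auto simp: right_ideal_def)
    then have "(\<odot>) \<alpha> ` S \<subseteq> tilde L K A m T" using I(2) by (rule subset_trans)
    then show "\<exists>\<alpha>\<in>S. (\<odot>) \<alpha> ` S \<subseteq> tilde L K A m T" using \<open>\<alpha> \<in> S\<close> by (rule bexI)
  qed
  finally show ?thesis .
qed

end
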